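(* For every integer $d \geq 3$ there exists a family $\left((z_n^L)_{n \in \mathbb{N}}\right)_{L \in \mathbb{N}}$ of uniformly distributed sequences, i.e. $(z_n^L)_{n\in\mathbb{N}} \in \mathcal{U}$ for every $L\in\mathbb{N}$, such that $$\lim_{L \to \infty} \limsup_{n \to \infty} \frac{1}{n} \sum_{i=1}^{n} f_{\min}(z_i^L,z_{i+1}^L,\ldots,z_{i+d-1}^L) = \frac{1}{d} = C_{f_{\min}}^d .$$
   Context: A sequence $(x_n)_{n\in\mathbb{N}}$ in $[0,1]$ is called uniformly distributed if for every interval $[a,b]\subseteq[0,1]$ one has $\lim_{n\to\infty}\frac1n\sum_{i=1}^n \mathbf{1}_{[a,b]}(x_i)=b-a$. $\mathcal{U}$ denotes the set of all uniformly distributed sequences in $[0,1]$. Write $[d]=\{1,\ldots,d\}$. The function $f_{\min}\colon[0,1]^d\to[0,1]$ is defined by $f_{\min}(x_1,\ldots,x_d)=\min_{i,j\in[d],\,i\neq j}|x_i-x_j|$. For continuous $f\colon[0,1]^d\to\mathbb{R}$, $$C_f^d := \sup_{\mathbf{x}^1,\ldots,\mathbf{x}^d \in \mathcal{U}} \ \limsup_{n \to \infty} \frac{1}{n} \sum_{i=1}^{n} f(x_i^1,x_i^2,\ldots,x_i^d),$$ where $x_i^j$ denotes the $i$-th element of the sequence $\mathbf{x}^j$. *)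

theory Defs
  imports "HOL-Analysis.Analysis"
begin

text \<open>
  Sequences are indexed by the positive integers; as functions on \<^typ>\<open>nat\<close> their value at
  \<open>0\<close> is unconstrained and never used.
\<close>

definition uniformly_distributed :: "(nat \<Rightarrow> real) \<Rightarrow> bool" where
  "uniformly_distributed x \<longleftrightarrow>
     (\<forall>i\<ge>1. x i \<in> {0..1}) \<and>
     (\<forall>a b. 0 \<le> a \<and> a \<le> b \<and> b \<le> 1 \<longrightarrow>
        (\<lambda>n. (1 / real n) * (\<Sum>i=1..n. indicator {a..b} (x i))) \<longlonglongrightarrow> b - a)"

definition unif_seqs :: "(nat \<Rightarrow> real) set" where
  "unif_seqs = {x. uniformly_distributed x}"

text \<open>
  A point \<open>(x\<^sub>1, \<dots>, x\<^sub>d)\<close> of \<open>[0,1]\<^sup>d\<close> is an element of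
  \<open>{1..d} \<rightarrow>\<^sub>E {0..1}\<close>, so a function of \<open>d\<close> variables has type
  \<^typ>\<open>(nat \<Rightarrow> real) \<Rightarrow> real\<close> and is only applied to such points.
\<close>

definition f_min :: "nat \<Rightarrow> (nat \<Rightarrow> real) \<Rightarrow> real" where
  "f_min d x = Min {\<bar>x i - x j\<bar> | i j. i \<in> {1..d} \<and> j \<in> {1..d} \<and> i \<noteq> j}"

text \<open>
  The supremum and limes superior are taken in \<^typ>\<open>ereal\<close>, where they are always meaningful;
  for continuous \<open>f\<close> on \<open>[0,1]\<^sup>d\<close> the value is finite.
\<close>

definition C_sup :: "nat \<Rightarrow> ((nat \<Rightarrow> real) \<Rightarrow> real) \<Rightarrow> ereal" where
  "C_sup d f =
     (SUP x \<in> {1..d} \<rightarrow>\<^sub>E unif_seqs.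
        limsup (\<lambda>n. ereal ((1 / real n) * (\<Sum>i=1..n. f (\<lambda>j\<in>{1..d}. x j i)))))"

end

theory Submission
  imports Defs "HOL-Library.Discrete_Functions" "HOL-Real_Asymp.Real_Asymp"
begin

text \<open>
  \<^emph>\<open>Upper bound.\<close> If \<open>d\<close> points are pairwise at distance at least \<open>m\<close>, then their largest and
  smallest members differ by at least \<open>(d - 1) m\<close>. So it is enough to bound the mean of
  maximum minus minimum. The \<open>d\<close> uniform marginals together have mass \<open>1\<close> above \<open>1 - 1/d\<close>, so
  the maximum does best by using all of this mass, which gives it mean \<open>1 - 1/(2d)\<close>; likewise
  the mean of the minimum is at least \<open>1/(2d)\<close>. The difference of the two is \<open>(d - 1)/d\<close>, and
  \<open>1/d\<close> bounds the mean of \<open>m\<close>. The formal version is the pointwise inequality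
  \<open>f_min_le_sum\<close>, which bounds \<open>f_min\<close> by a sum of functions of one variable each; their
  averages along uniformly distributed sequences are controlled by
  \<open>average_positive_part_eventually_le\<close>.

  \<^emph>\<open>Sharpness.\<close> Equality needs the \<open>d\<close> points to be spaced by exactly \<open>1/d\<close>. The sequence
  \<open>comb_seq d\<close> jumps cyclically through the \<open>d\<close> intervals of length \<open>1/d\<close>, with a
  relative position inside the interval that creeps ever more slowly upwards from \<open>0\<close> to \<open>1\<close>,
  again and again. Any \<open>d\<close> consecutive members lie in different intervals at almost the same relative
  position, so their separation tends to \<open>1/d\<close> (\<open>comb_seq_separated\<close>); and one upward
  pass visits each point of an equidistant grid exactly once, which makes the sequence uniformly
  distributed (\<open>comb_seq_uniformly_distributed\<close>). As the slowing down is built into a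
  single sequence, its windows attain the limit \<open>1/d\<close> exactly, and the family of the theorem
  is taken to be constant. Finally, the shifts of a uniformly distributed sequence are uniformly distributed, so
  averages over windows compete in the supremum that defines \<open>C_sup\<close>.
\<close>

section \<open>Averages\<close>

lemma averages_eventually_ge:
  fixes g :: "nat \<Rightarrow> real"
  assumes ev: "\<forall>\<^sub>F n in sequentially. c \<le> g n" and e: "e > 0"
  shows "\<forall>\<^sub>F n in sequentially. c - e \<le> (1 / real n) * (\<Sum>i=1..n. g i)"
proof -
  obtain N where N: "\<And>n. n \<ge> N \<Longrightarrow> c \<le> g n"
    using ev unfolding eventually_sequentially by blast
  define B where "B = \<bar>\<Sum>i=1..N. g i - c\<bar>"
  have "(\<lambda>n. B / real n) \<longlonglongrightarrow> 0"
    by real_asymp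
  then have "\<forall>\<^sub>F n in sequentially. B / real n < e"
    using e by (rule order_tendstoD(2))
  with eventually_ge_at_top[of "N + 1"] show ?thesis
  proof eventually_elim
    case (elim n)
    have n: "real n > 0" using elim by simp
    \<comment> \<open>Only the first \<open>N\<close> terms can lie below \<open>c\<close>; their total deficit \<open>B\<close> is divided by \<open>n\<close>.\<close>
    have split: "{1..n} = {1..N} \<union> {N<..n}"
      using elim by auto
    have "(\<Sum>i=1..n. g i - c) = (\<Sum>i=1..N. g i - c) + (\<Sum>i\<in>{N<..n}. g i - c)"
      unfolding split by (rule sum.union_disjoint) auto
    moreover have "(\<Sum>i\<in>{N<..n}. g i - c) \<ge> 0"
      by (rule sum_nonneg) (use N in auto)
    ultimately have "(\<Sum>i=1..n. g i - c) \<ge> - B"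
      unfolding B_def by linarith
    then have "(\<Sum>i=1..n. g i) \<ge> real n * c - B"
      by (simp add: sum_subtractf)
    moreover have "B < e * real n"
      using elim n by (simp add: field_simps)
    ultimately have "(\<Sum>i=1..n. g i) \<ge> real n * (c - e)"
      by (simp add: algebra_simps)
    then show ?case using n by (simp add: field_simps)
  qed
qed

section \<open>Uniformly distributed sequences\<close>

lemma uniformly_distributedD:
  assumes "uniformly_distributed x" "0 \<le> a" "a \<le> b" "b \<le> 1"
  shows "(\<lambda>n. (1 / real n) * (\<Sum>i=1..n. indicator {a..b} (x i))) \<longlonglongrightarrow> b - a"
  using assms unfolding uniformly_distributed_def by blast

lemma uniformly_distributed_Suc:
  assumes x: "uniformly_distributed x"
  shows "uniformly_distributed (\<lambda>i. x (Suc i))"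
  unfolding uniformly_distributed_def
proof (intro conjI allI impI)
  fix i :: nat assume "i \<ge> 1"
  then show "x (Suc i) \<in> {0..1}"
    using x unfolding uniformly_distributed_def by simp
next
  fix a b :: real assume ab: "0 \<le> a \<and> a \<le> b \<and> b \<le> 1"
  let ?g = "\<lambda>i. indicator {a..b} (x i) :: real"
  let ?A = "\<lambda>n. (1 / real n) * (\<Sum>i=1..n. ?g i)"
  have "?A \<longlonglongrightarrow> b - a"
    using uniformly_distributedD[OF x] ab by blast
  then have lim: "(\<lambda>n. ?A (Suc n)) \<longlonglongrightarrow> b - a"
    by (rule LIMSEQ_Suc)
  have q: "(\<lambda>n. real (Suc n) / real n) \<longlonglongrightarrow> 1"
    by real_asymp
  have c: "(\<lambda>n. ?g 1 / real n) \<longlonglongrightarrow> 0"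
    by (rule tendsto_divide_0[OF tendsto_const]) (rule filterlim_at_top_imp_at_infinity, rule filterlim_real_sequentially)
  have "(\<lambda>n. real (Suc n) / real n * ?A (Suc n) - ?g 1 / real n) \<longlonglongrightarrow> 1 * (b - a) - 0"
    by (intro tendsto_intros lim q c)
  moreover have "(1 / real n) * (\<Sum>i=1..n. ?g (Suc i))
      = real (Suc n) / real n * ?A (Suc n) - ?g 1 / real n" for n
  proof -
    have "(\<Sum>i=1..n. ?g (Suc i)) = (\<Sum>i=1..Suc n. ?g i) - ?g 1"
      by (simp add: sum.atLeast1_atMost_eq sum.lessThan_Suc_shift del: sum.cl_ivl_Suc sum.lessThan_Suc)
    then show ?thesis
      by (simp only:) (simp add: diff_divide_distrib del: sum.cl_ivl_Suc of_nat_Suc)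
  qed
  ultimately show "(\<lambda>n. (1 / real n) * (\<Sum>i=1..n. indicator {a..b} (x (Suc i)))) \<longlonglongrightarrow> b - a"
    by simp
qed

lemma uniformly_distributed_shift:
  assumes "uniformly_distributed x"
  shows "uniformly_distributed (\<lambda>i. x (i + m))"
proof (induction m)
  case 0
  then show ?case using assms by simp
next
  case (Suc m)
  from uniformly_distributed_Suc[OF this] show ?case by simp
qed

lemma uniformly_distributed_reflect:
  assumes x: "uniformly_distributed x"
  shows "uniformly_distributed (\<lambda>i. 1 - x i)"
  unfolding uniformly_distributed_def
proof (intro conjI allI impI)
  fix i :: nat assume "i \<ge> 1"
  then show "1 - x i \<in> {0..1}"
    using x unfolding uniformly_distributed_def by auto
next
  fix a b :: real assume ab: "0 \<le> a \<and> a \<le> b \<and> b \<le> 1"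
  have "indicator {a..b} (1 - x i) = (indicator {1 - b..1 - a} (x i) :: real)" for i
    by (auto simp: indicator_def)
  moreover have "(\<lambda>n. (1 / real n) * (\<Sum>i=1..n. indicator {1 - b..1 - a} (x i)))
      \<longlonglongrightarrow> (1 - a) - (1 - b)"
    using ab by (intro uniformly_distributedD[OF x]) auto
  ultimately show "(\<lambda>n. (1 / real n) * (\<Sum>i=1..n. indicator {a..b} (1 - x i))) \<longlonglongrightarrow> b - a"
    by simp
qed

text \<open>
  Uniform distribution speaks about indicators of intervals only. A ramp lies below the
  staircase that takes a step up by \<open>\<delta>\<close> at every multiple of \<open>\<delta>\<close> beyond its foot, and a staircase is a sum
  of such indicators.
\<close>

lemma positive_part_le_staircase:
  fixes c t \<delta> :: real
  assumes \<delta>: "0 \<le> \<delta>" and t: "t \<le> c + real K * \<delta>" "t \<le> 1"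
  shows "max 0 (t - c) \<le> \<delta> * (\<Sum>k<K. indicator {c + real k * \<delta>..1} t)"
  using t(1)
proof (induction K)
  case 0
  then show ?case by simp
next
  case (Suc K)
  let ?S = "\<lambda>K. \<Sum>k<K. indicator {c + real k * \<delta>..1} t :: real"
  show ?case
  proof (cases "t \<le> c + real K * \<delta>")
    case True
    have "\<delta> * ?S K \<le> \<delta> * ?S (Suc K)"
      using \<delta> by (intro mult_left_mono) (auto simp: indicator_def)
    then show ?thesis using Suc.IH[OF True] by linarith
  next
    case False
    have le: "c + real k * \<delta> \<le> t" if "k < Suc K" for k
    proof -
      have "real k * \<delta> \<le> real K * \<delta>"
        using that \<delta> by (intro mult_right_mono) auto
      then show ?thesis using False by linarith
    qed
    have "?S (Suc K) = (\<Sum>k<Suc K. 1)"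
      by (rule sum.cong) (use le t(2) in \<open>auto simp: indicator_def\<close>)
    then show ?thesis
      using Suc.prems \<delta> by (simp add: algebra_simps)
  qed
qed

text \<open>
  The value \<open>(1 - c)\<^sup>2 / 2\<close> is the integral of the ramp over the unit interval. A staircase with
  \<open>K\<close> steps overestimates it by \<open>(1 - c)\<^sup>2 / (2 K)\<close>, which is below \<open>e\<close> for large \<open>K\<close>. This
  one-sided estimate suffices, because ramps occur only in upper bounds.
\<close>

lemma average_positive_part_eventually_le:
  assumes x: "uniformly_distributed x" and c: "0 \<le> c" "c \<le> 1" and e: "e > 0"
  shows "\<forall>\<^sub>F n in sequentially.
    (1 / real n) * (\<Sum>i=1..n. max 0 (x i - c)) \<le> (1 - c)\<^sup>2 / 2 + e"
proof -
  have "(\<lambda>K. (1 - c)\<^sup>2 / (2 * real K)) \<longlonglongrightarrow> 0"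
    by real_asymp
  then have "\<forall>\<^sub>F K in sequentially. (1 - c)\<^sup>2 / (2 * real K) < e \<and> K > 0"
    by (intro eventually_conj order_tendstoD(2)[OF _ e] eventually_gt_at_top)
  from eventually_happens'[OF sequentially_bot this]
  obtain K where K: "(1 - c)\<^sup>2 / (2 * real K) < e" "K > 0"
    by blast
  define \<delta> where "\<delta> = (1 - c) / real K"
  have \<delta>: "\<delta> \<ge> 0" "real K * \<delta> = 1 - c"
    using c K unfolding \<delta>_def by auto
  let ?I = "\<lambda>k i. indicator {c + real k * \<delta>..1} (x i) :: real"
  have "(\<lambda>n. \<delta> * (\<Sum>k<K. (1 / real n) * (\<Sum>i=1..n. ?I k i)))
      \<longlonglongrightarrow> \<delta> * (\<Sum>k<K. 1 - (c + real k * \<delta>))"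
  proof (intro tendsto_intros uniformly_distributedD[OF x])
    fix k assume "k \<in> {..<K}"
    then have "real k * \<delta> \<le> real K * \<delta>"
      using \<delta> by (intro mult_right_mono) auto
    then show "c + real k * \<delta> \<le> 1" using \<delta> by simp
  qed (use c \<delta> in auto)
  moreover have "\<delta> * (\<Sum>k<K. 1 - (c + real k * \<delta>)) = (1 - c)\<^sup>2 / 2 + (1 - c)\<^sup>2 / (2 * real K)"
  proof -
    have gauss: "(\<Sum>k<K. real k) = real K * (real K - 1) / 2"
      by (induction K) (auto simp: field_simps)
    have "(\<Sum>k<K. 1 - (c + real k * \<delta>)) = (\<Sum>k<K. (1 - c) - real k * \<delta>)"
      by (intro sum.cong refl) simp
    also have "\<dots> = real K * (1 - c) - (\<Sum>k<K. real k) * \<delta>"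
      by (simp only: sum_subtractf sum_distrib_right) (simp add: right_diff_distrib)
    also have "\<dots> = real K * (1 - c) - (real K - 1) / 2 * (1 - c)"
      unfolding gauss \<delta>(2)[symmetric] by simp
    also have "\<dots> = (1 - c) * (real K + 1) / 2"
      by (simp add: field_simps)
    finally show ?thesis
      using K(2) unfolding \<delta>_def by (simp add: add_divide_distrib distrib_left power2_eq_square)
  qed
  ultimately have "\<forall>\<^sub>F n in sequentially.
      \<delta> * (\<Sum>k<K. (1 / real n) * (\<Sum>i=1..n. ?I k i)) < (1 - c)\<^sup>2 / 2 + e"
    by (elim order_tendstoD(2)) (use K in auto)
  then show ?thesis
  proof eventually_elim
    case (elim n)
    have "(\<Sum>i=1..n. max 0 (x i - c)) \<le> (\<Sum>i=1..n. \<delta> * (\<Sum>k<K. ?I k i))"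
      using x \<delta> by (intro sum_mono positive_part_le_staircase)
        (auto simp: uniformly_distributed_def)
    also have "\<dots> = \<delta> * (\<Sum>k<K. \<Sum>i=1..n. ?I k i)"
      by (subst sum.swap) (simp add: sum_distrib_left)
    finally have "(1 / real n) * (\<Sum>i=1..n. max 0 (x i - c))
        \<le> (1 / real n) * (\<delta> * (\<Sum>k<K. \<Sum>i=1..n. ?I k i))"
      by (rule mult_left_mono) simp
    also have "\<dots> = \<delta> * (\<Sum>k<K. (1 / real n) * (\<Sum>i=1..n. ?I k i))"
      by (simp only: sum_distrib_left mult.left_commute)
    finally show ?case using elim by linarith
  qed
qed

section \<open>The upper bound\<close>

text \<open>
  The gaps between neighbours in sorted order add up. The induction adds the points in
  increasing order, so that each new point lies at least \<open>m\<close> above all earlier ones.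
\<close>

lemma separated_points_spread:
  fixes x :: "'a \<Rightarrow> real"
  assumes "finite A" and "A \<noteq> {}"
    and "\<And>i j. i \<in> A \<Longrightarrow> j \<in> A \<Longrightarrow> i \<noteq> j \<Longrightarrow> m \<le> \<bar>x i - x j\<bar>"
  shows "\<exists>i\<in>A. \<exists>j\<in>A. (real (card A) - 1) * m \<le> x j - x i"
  using assms
proof (induction rule: finite_ranking_induct[where f = x])
  case empty
  then show ?case by simp
next
  case (insert p A)
  consider "A = {}" | "p \<in> A" | "p \<notin> A" "A \<noteq> {}"
    by blast
  then show ?case
  proof cases
    case 1
    then show ?thesis by simp
  next
    case 2
    then have "insert p A = A" by blast
    then show ?thesis
      using insert.IH insert.prems by metis
  next
    case 3
    then obtain i j where ij: "i \<in> A" "j \<in> A" "(real (card A) - 1) * m \<le> x j - x i"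
      using insert.IH insert.prems by auto
    have "m \<le> \<bar>x p - x j\<bar>"
      using ij 3 by (intro insert.prems) auto
    moreover have "x j \<le> x p"
      using insert.hyps ij by blast
    ultimately have "(real (card (insert p A)) - 1) * m \<le> x p - x i"
      using ij(3) 3 insert.hyps(1) by (simp add: algebra_simps)
    then show ?thesis using ij by blast
  qed
qed

lemma finite_f_min_distances:
  fixes d :: nat and x :: "nat \<Rightarrow> real"
  shows "finite {\<bar>x i - x j\<bar> | i j. i \<in> {1..d} \<and> j \<in> {1..d} \<and> i \<noteq> j}"
proof (rule finite_subset)
  show "{\<bar>x i - x j\<bar> | i j. i \<in> {1..d} \<and> j \<in> {1..d} \<and> i \<noteq> j}
      \<subseteq> (\<lambda>(i, j). \<bar>x i - x j\<bar>) ` ({1..d} \<times> {1..d})"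
    by auto
  show "finite ((\<lambda>(i, j). \<bar>x i - x j\<bar>) ` ({1..d} \<times> {1..d}))"
    by (intro finite_imageI finite_cartesian_product) simp_all
qed

lemma f_min_le_dist:
  assumes "i \<in> {1..d}" "j \<in> {1..d}" "i \<noteq> j"
  shows "f_min d x \<le> \<bar>x i - x j\<bar>"
  unfolding f_min_def using assms by (intro Min_le finite_f_min_distances) blast

lemma f_min_geI:
  assumes "d \<ge> 2"
    and "\<And>i j. i \<in> {1..d} \<Longrightarrow> j \<in> {1..d} \<Longrightarrow> i < j \<Longrightarrow> c \<le> \<bar>x i - x j\<bar>"
  shows "c \<le> f_min d x"
  unfolding f_min_def
proof (rule Min.boundedI[OF finite_f_min_distances])
  have "1 \<in> {1..d}" "2 \<in> {1..d}" "(1::nat) \<noteq> 2"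
    using assms(1) by auto
  then show "{\<bar>x i - x j\<bar> | i j. i \<in> {1..d} \<and> j \<in> {1..d} \<and> i \<noteq> j} \<noteq> {}"
    by blast
next
  fix y assume "y \<in> {\<bar>x i - x j\<bar> | i j. i \<in> {1..d} \<and> j \<in> {1..d} \<and> i \<noteq> j}"
  then obtain i j where "y = \<bar>x i - x j\<bar>" "i \<in> {1..d}" "j \<in> {1..d}" "i \<noteq> j"
    by blast
  then show "c \<le> y"
    using assms(2)[of i j] assms(2)[of j i] by (cases "i < j") (auto simp: abs_minus_commute)
qed

text \<open>
  This is the dual certificate for the upper bound. The largest point exceeds \<open>1 - 1/d\<close> by at most
  the sum of all upper excesses, and reflection gives the same for the smallest point and
  \<open>1/d\<close>. The thresholds are chosen so that equality holds when one point lies in each of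
  the \<open>d\<close> intervals of length \<open>1/d\<close> and the points are equally spaced.
\<close>

lemma f_min_le_sum:
  assumes d: "d \<ge> 1"
  shows "(real d - 1) * f_min d x \<le> 1 - 2 / real d +
    (\<Sum>j=1..d. max 0 (x j - (1 - 1 / real d)) + max 0 ((1 - x j) - (1 - 1 / real d)))"
proof -
  let ?c = "1 - 1 / real d"
  have "\<exists>i\<in>{1..d}. \<exists>j\<in>{1..d}. (real (card {1..d}) - 1) * f_min d x \<le> x j - x i"
    using d by (intro separated_points_spread f_min_le_dist) auto
  then obtain i j where ij: "i \<in> {1..d}" "j \<in> {1..d}" "(real d - 1) * f_min d x \<le> x j - x i"
    by auto
  have "x j - ?c \<le> (\<Sum>j=1..d. max 0 (x j - ?c))"
    using member_le_sum[of j "{1..d}" "\<lambda>j. max 0 (x j - ?c)"] ij by auto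
  moreover have "(1 - x i) - ?c \<le> (\<Sum>i=1..d. max 0 ((1 - x i) - ?c))"
    using member_le_sum[of i "{1..d}" "\<lambda>i. max 0 ((1 - x i) - ?c)"] ij by auto
  ultimately show ?thesis
    using ij(3) by (simp add: sum.distrib)
qed

lemma average_f_min_eventually_le:
  assumes d: "d \<ge> 2" and x: "\<And>j. j \<in> {1..d} \<Longrightarrow> uniformly_distributed (x j)" and e: "e > 0"
  shows "\<forall>\<^sub>F n in sequentially.
    (1 / real n) * (\<Sum>i=1..n. f_min d (\<lambda>j\<in>{1..d}. x j i)) \<le> 1 / real d + e"
proof -
  define c where "c = 1 - 1 / real d"
  \<comment> \<open>Each of the \<open>2 d\<close> ramps may be off by \<open>e'\<close>, and the total is divided by \<open>d - 1\<close>.\<close>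
  define e' where "e' = (real d - 1) * e / (2 * real d)"
  have c: "0 \<le> c" "c \<le> 1" using d by (auto simp: c_def)
  have e': "e' > 0" using d e by (auto simp: e'_def)
  let ?P = "\<lambda>y n. (1 / real n) * (\<Sum>i=1..n. max 0 (y i - c))"
  have "\<forall>\<^sub>F n in sequentially. \<forall>j\<in>{1..d}. ?P (x j) n \<le> (1 - c)\<^sup>2 / 2 + e'"
    by (intro eventually_ball_finite ballI average_positive_part_eventually_le x c e') auto
  moreover have "\<forall>\<^sub>F n in sequentially. \<forall>j\<in>{1..d}. ?P (\<lambda>i. 1 - x j i) n \<le> (1 - c)\<^sup>2 / 2 + e'"
    by (intro eventually_ball_finite ballI average_positive_part_eventually_le
        uniformly_distributed_reflect x c e') auto
  ultimately show ?thesis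
    using eventually_gt_at_top[of 0]
  proof eventually_elim
    case (elim n)
    let ?f = "\<lambda>i. f_min d (\<lambda>j\<in>{1..d}. x j i)"
    let ?h = "\<lambda>j i. max 0 (x j i - c) + max 0 ((1 - x j i) - c)"
    have "(real d - 1) * ?f i \<le> 1 - 2 / real d + (\<Sum>j=1..d. ?h j i)" for i
      using f_min_le_sum[of d "\<lambda>j\<in>{1..d}. x j i"] d unfolding c_def by simp
    then have "(\<Sum>i=1..n. (real d - 1) * ?f i) \<le> (\<Sum>i=1..n. 1 - 2 / real d + (\<Sum>j=1..d. ?h j i))"
      by (rule sum_mono)
    also have "\<dots> = real n * (1 - 2 / real d) + (\<Sum>j=1..d. \<Sum>i=1..n. ?h j i)"
      by (subst sum.swap) (simp add: sum.distrib)
    finally have "(1 / real n) * (\<Sum>i=1..n. (real d - 1) * ?f i)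
        \<le> (1 / real n) * (real n * (1 - 2 / real d) + (\<Sum>j=1..d. \<Sum>i=1..n. ?h j i))"
      by (rule mult_left_mono) simp
    also have "\<dots> = (1 - 2 / real d) + (1 / real n) * (\<Sum>j=1..d. \<Sum>i=1..n. ?h j i)"
      using elim by (simp add: ring_distribs)
    also have "(1 / real n) * (\<Sum>j=1..d. \<Sum>i=1..n. ?h j i)
        = (\<Sum>j=1..d. ?P (x j) n + ?P (\<lambda>i. 1 - x j i) n)"
      by (simp only: sum.distrib sum_distrib_left ring_distribs)
    also have "\<dots> \<le> (\<Sum>j=1..d. ((1 - c)\<^sup>2 / 2 + e') + ((1 - c)\<^sup>2 / 2 + e'))"
      using elim by (intro sum_mono add_mono) auto
    also have "\<dots> = 1 / real d + (real d - 1) * e"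
      using d by (simp add: c_def e'_def field_simps power2_eq_square)
    also have "1 - 2 / real d + (1 / real d + (real d - 1) * e) = (real d - 1) * (1 / real d + e)"
      using d by (simp add: field_simps)
    finally have "(real d - 1) * ((1 / real n) * (\<Sum>i=1..n. ?f i)) \<le> (real d - 1) * (1 / real d + e)"
      by (simp only: mult.left_commute flip: sum_distrib_left)
    then show ?case
      by (rule mult_left_le_imp_le) (use d in simp)
  qed
qed

lemma C_sup_f_min_le:
  assumes d: "d \<ge> 2"
  shows "C_sup d (f_min d) \<le> ereal (1 / real d)"
  unfolding C_sup_def
proof (rule SUP_least, rule ereal_le_epsilon2)
  fix x and e :: real
  assume x: "x \<in> {1..d} \<rightarrow>\<^sub>E unif_seqs" and e: "0 < e"
  have "\<forall>\<^sub>F n in sequentially.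
      (1 / real n) * (\<Sum>i=1..n. f_min d (\<lambda>j\<in>{1..d}. x j i)) \<le> 1 / real d + e"
    by (rule average_f_min_eventually_le[OF d _ e]) (use x in \<open>auto simp: unif_seqs_def\<close>)
  then show "limsup (\<lambda>n. ereal ((1 / real n) * (\<Sum>i=1..n. f_min d (\<lambda>j\<in>{1..d}. x j i))))
      \<le> ereal (1 / real d) + ereal e"
    by (intro Limsup_bounded) (auto elim: eventually_mono)
qed

section \<open>A sequence with spread-out windows\<close>

text \<open>
  With \<open>k\<close> the integer part of the square root of \<open>m\<close>, this is the linear interpolation of the
  fractional part of that square root: on the \<open>2 k + 1\<close> numbers from \<open>k\<^sup>2\<close> to \<open>(k + 1)\<^sup>2 - 1\<close> it
  climbs from \<open>0\<close> in steps of \<open>1 / (2 k + 1)\<close>, without reaching \<open>1\<close>.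
\<close>

definition sweep :: "nat \<Rightarrow> real" where
  "sweep m = (real m - (real (floor_sqrt m))\<^sup>2) / (2 * real (floor_sqrt m) + 1)"

definition comb_seq :: "nat \<Rightarrow> nat \<Rightarrow> real" where
  "comb_seq d n = (real (n mod d) + sweep (n div d)) / real d"

lemma floor_sqrt_bounds:
  "(real (floor_sqrt m))\<^sup>2 \<le> real m" "real m < (real (floor_sqrt m) + 1)\<^sup>2"
proof -
  have "real ((floor_sqrt m)\<^sup>2) \<le> real m" "real m < real ((Suc (floor_sqrt m))\<^sup>2)"
    unfolding of_nat_le_iff of_nat_less_iff
    by (rule floor_sqrt_power2_le, rule Suc_floor_sqrt_power2_gt)
  then show "(real (floor_sqrt m))\<^sup>2 \<le> real m" "real m < (real (floor_sqrt m) + 1)\<^sup>2"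
    by (simp_all add: add.commute)
qed

lemma sweep_nonneg: "0 \<le> sweep m"
  using floor_sqrt_bounds(1)[of m] unfolding sweep_def by simp

lemma sweep_less_1: "sweep m < 1"
  using floor_sqrt_bounds(2)[of m] unfolding sweep_def
  by (simp add: divide_less_eq power2_eq_square algebra_simps)

text \<open>
  Only increases are small: at every square the value drops from nearly \<open>1\<close> to \<open>0\<close>. A one-sided
  bound is enough for the separation of windows below.
\<close>

lemma sweep_step: "sweep (Suc m) - sweep m \<le> 1 / (2 * real (floor_sqrt m) + 1)"
proof (cases "floor_sqrt (Suc m) = floor_sqrt m")
  case True
  then show ?thesis
    unfolding sweep_def by (simp add: diff_divide_distrib[symmetric])
next
  case False
  have "floor_sqrt m \<le> floor_sqrt (Suc m)"
    by (rule mono_floor_sqrt') simp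
  with False have "(Suc (floor_sqrt m))\<^sup>2 \<le> (floor_sqrt (Suc m))\<^sup>2"
    by (intro power_mono) auto
  with floor_sqrt_power2_le[of "Suc m"] Suc_floor_sqrt_power2_gt[of m]
  have "(floor_sqrt (Suc m))\<^sup>2 = Suc m"
    by linarith
  then have "(real (floor_sqrt (Suc m)))\<^sup>2 = real (Suc m)"
    by (metis of_nat_power)
  then have "sweep (Suc m) = 0"
    unfolding sweep_def by simp
  then show ?thesis
    using sweep_nonneg[of m] by (simp add: add_nonneg_nonneg order_trans[of _ 0])
qed

lemma comb_seq_range:
  assumes "d > 0"
  shows "comb_seq d n \<in> {0..1}"
proof -
  have "n mod d + 1 \<le> d" using assms by (simp add: Suc_leI)
  then have "real (n mod d) + 1 \<le> real d" by linarith
  then show ?thesis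
    unfolding comb_seq_def using sweep_nonneg[of "n div d"] sweep_less_1[of "n div d"] assms
    by (simp add: divide_le_eq)
qed

text \<open>
  Two members of a window lie in different intervals of length \<open>1/d\<close>. If both belong to the same round
  through the intervals, they have the same relative position and the distance is at least \<open>1/d\<close>. Otherwise the
  later one belongs to the next round and, as fewer than \<open>d\<close> steps have passed, to an
  interval further down. So an increase of the relative position brings the two closer, but only by
  a small amount, and a drop moves them further apart.
\<close>

lemma comb_seq_separated:
  assumes d: "d > 0" and n: "n < n'" "n' < n + d"
  shows "(1 - 1 / (2 * real (floor_sqrt (n div d)) + 1)) / real d
    \<le> \<bar>comb_seq d n - comb_seq d n'\<bar>"
proof -
  define m r m' r' where "m = n div d" and "r = n mod d" and "m' = n' div d" and "r' = n' mod d"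
  define \<delta> where "\<delta> = 1 / (2 * real (floor_sqrt m) + 1)"
  have r: "r < d" "r' < d" and eqs: "n = d * m + r" "n' = d * m' + r'"
    using d by (simp_all add: m_def r_def m'_def r'_def)
  have \<delta>: "\<delta> \<ge> 0" by (simp add: \<delta>_def)
  have "m \<le> m'" unfolding m_def m'_def using n by (intro div_le_mono) auto
  moreover have "m' \<le> m + 1"
  proof -
    have "n' div d \<le> (n + d) div d" using n by (intro div_le_mono) auto
    then show ?thesis using d by (simp add: m_def m'_def)
  qed
  ultimately consider "m' = m" | "m' = Suc m" by linarith
  then have "1 - \<delta> \<le> \<bar>(real r + sweep m) - (real r' + sweep m')\<bar>"
  proof cases
    case 1
    then have "r < r'" using eqs n by simp
    then show ?thesis using 1 \<delta> by simp
  next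
    case 2
    then have "r' < r" using eqs n by simp
    then have "real r' + 1 \<le> real r" by linarith
    then show ?thesis using sweep_step[of m] 2 unfolding \<delta>_def 2 by linarith
  qed
  then have "(1 - \<delta>) / real d \<le> \<bar>(real r + sweep m) - (real r' + sweep m')\<bar> / real d"
    by (rule divide_right_mono) simp
  also have "\<dots> = \<bar>comb_seq d n - comb_seq d n'\<bar>"
    unfolding comb_seq_def m_def r_def m'_def r'_def using d
    by (simp add: diff_divide_distrib[symmetric])
  finally show ?thesis unfolding \<delta>_def m_def .
qed

text \<open>
  One upward pass of the relative position is \<open>2 k + 1\<close> rounds of \<open>d\<close> members each. The member in
  round \<open>s\<close> and interval \<open>r\<close> is the grid point with number \<open>j = r (2 k + 1) + s\<close>; division with
  remainder shows that every grid point occurs exactly once.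
\<close>

lemma comb_seq_block_sum:
  fixes g :: "real \<Rightarrow> real"
  assumes d: "d > 0"
  shows "(\<Sum>n=d * k\<^sup>2..<d * (Suc k)\<^sup>2. g (comb_seq d n))
    = (\<Sum>j<d * (2 * k + 1). g (real j / real (d * (2 * k + 1))))"
proof (rule sum.reindex_bij_witness[where
      i = "\<lambda>j. d * (k\<^sup>2 + j mod (2 * k + 1)) + j div (2 * k + 1)" and
      j = "\<lambda>n. (n mod d) * (2 * k + 1) + (n div d - k\<^sup>2)"])
  fix n assume n: "n \<in> {d * k\<^sup>2..<d * (Suc k)\<^sup>2}"
  define s where "s = n div d - k\<^sup>2"
  have lo: "k\<^sup>2 \<le> n div d"
    using div_le_mono[of "d * k\<^sup>2" n d] n d by simp
  have "n div d < (Suc k)\<^sup>2"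
    using n by (intro less_mult_imp_div_less) (simp add: mult.commute)
  then have s: "s < 2 * k + 1" "n div d = k\<^sup>2 + s"
    using lo by (simp_all add: s_def power2_eq_square)
  have r: "n mod d < d" using d by simp
  have *: "(n mod d * (2 * k + 1) + s) div (2 * k + 1) = n mod d"
    "(n mod d * (2 * k + 1) + s) mod (2 * k + 1) = s"
    using s(1) by (simp_all add: div_mult_self3 del: mult_Suc_right)
  show "d * (k\<^sup>2 + (n mod d * (2 * k + 1) + (n div d - k\<^sup>2)) mod (2 * k + 1))
      + (n mod d * (2 * k + 1) + (n div d - k\<^sup>2)) div (2 * k + 1) = n"
    unfolding s_def[symmetric] * s(2)[symmetric] by simp
  have "n mod d * (2 * k + 1) + s < (n mod d + 1) * (2 * k + 1)"
    using s(1) by simp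
  also have "\<dots> \<le> d * (2 * k + 1)"
    using r by (intro mult_le_mono1) simp
  finally show "n mod d * (2 * k + 1) + (n div d - k\<^sup>2) \<in> {..<d * (2 * k + 1)}"
    by (simp add: s_def)
  have fs: "floor_sqrt (n div d) = k"
    by (rule floor_sqrt_unique) (use lo \<open>n div d < (Suc k)\<^sup>2\<close> in auto)
  have "comb_seq d n = (real (n mod d) + real s / (2 * real k + 1)) / real d"
    unfolding comb_seq_def sweep_def fs unfolding s(2) by simp
  also have "\<dots> = (real (n mod d) * (2 * real k + 1) + real s) / (real d * (2 * real k + 1))"
    by (simp add: add_divide_distrib)
  also have "\<dots> = real (n mod d * (2 * k + 1) + s) / real (d * (2 * k + 1))"
    by (simp only: of_nat_add of_nat_mult of_nat_numeral of_nat_1)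
  finally show "g (real (n mod d * (2 * k + 1) + (n div d - k\<^sup>2)) / real (d * (2 * k + 1)))
      = g (comb_seq d n)"
    by (simp add: s_def)
next
  fix j assume j: "j \<in> {..<d * (2 * k + 1)}"
  define r s where "r = j div (2 * k + 1)" and "s = j mod (2 * k + 1)"
  have r: "r < d"
    unfolding r_def using j by (intro less_mult_imp_div_less) simp
  have s: "s < 2 * k + 1" unfolding s_def by simp
  have *: "(d * (k\<^sup>2 + s) + r) div d = k\<^sup>2 + s" "(d * (k\<^sup>2 + s) + r) mod d = r"
    using r by simp_all
  show "(d * (k\<^sup>2 + j mod (2 * k + 1)) + j div (2 * k + 1)) mod d * (2 * k + 1) +
      ((d * (k\<^sup>2 + j mod (2 * k + 1)) + j div (2 * k + 1)) div d - k\<^sup>2) = j"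
    unfolding r_def[symmetric] s_def[symmetric] *
    unfolding r_def s_def by (metis add_diff_cancel_left' div_mult_mod_eq)
  have "d * (k\<^sup>2 + s) + r < d * (k\<^sup>2 + s + 1)" using r by simp
  also have "\<dots> \<le> d * (Suc k)\<^sup>2"
    using s by (intro mult_le_mono2) (simp add: power2_eq_square)
  finally show "d * (k\<^sup>2 + j mod (2 * k + 1)) + j div (2 * k + 1) \<in> {d * k\<^sup>2..<d * (Suc k)\<^sup>2}"
    by (simp add: r_def s_def trans_le_add1)
qed

lemma grid_discrepancy:
  fixes a b :: real
  assumes ab: "0 \<le> a" "a \<le> b" "b \<le> 1" and M: "M > 0"
  shows "\<bar>\<Sum>j<M. indicator {a..b} (real j / real M) - (b - a)\<bar> \<le> 1"
proof -
  \<comment> \<open>The right endpoint \<open>1\<close> is not a grid point, so \<open>b = 1\<close> needs a separate bound.\<close>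
  let ?B = "if b = 1 then M else nat (floor (b * real M)) + 1"
  let ?A = "nat (ceiling (a * real M))"
  have a0: "0 \<le> a * real M" and le: "a * real M \<le> b * real M"
    using ab by (auto intro: mult_right_mono)
  have eq: "{j. j < M \<and> real j / real M \<in> {a..b}} = {?A..<?B}"
  proof (intro set_eqI)
    fix j
    have "a \<le> real j / real M \<longleftrightarrow> a * real M \<le> real j"
      using M by (simp add: field_simps)
    also have "\<dots> \<longleftrightarrow> ?A \<le> j"
      by linarith
    finally have 1: "a \<le> real j / real M \<longleftrightarrow> ?A \<le> j" .
    have 2: "j < M \<and> real j / real M \<le> b \<longleftrightarrow> j < ?B"
    proof (cases "b = 1")
      case True
      then show ?thesis using M by (auto simp: divide_le_eq)
    next
      case False
      then have "b * real M < real M" using ab M by simp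
      moreover have "real j / real M \<le> b \<longleftrightarrow> real j \<le> b * real M"
        using M by (simp add: field_simps)
      moreover have "real j \<le> b * real M \<longleftrightarrow> j < nat (floor (b * real M)) + 1"
        using a0 le by linarith
      ultimately show ?thesis using False by auto
    qed
    show "j \<in> {j. j < M \<and> real j / real M \<in> {a..b}} \<longleftrightarrow> j \<in> {?A..<?B}"
      using 1 2 by auto
  qed
  have "(\<Sum>j<M. indicator {a..b} (real j / real M)) = (\<Sum>j\<in>{j. j < M \<and> real j / real M \<in> {a..b}}. 1 :: real)"
    by (rule sum.mono_neutral_cong_right) (auto simp: indicator_def)
  also have "\<dots> = real (?B - ?A)"
    unfolding eq by simp
  finally have sum: "(\<Sum>j<M. indicator {a..b} (real j / real M)) = real (?B - ?A)" .
  have "\<bar>real (?B - ?A) - (b * real M - a * real M)\<bar> \<le> 1"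
    using a0 le by (cases "b = 1") (simp; linarith)+
  moreover have "(\<Sum>j<M. indicator {a..b} (real j / real M) - (b - a))
      = real (?B - ?A) - (b * real M - a * real M)"
    unfolding sum_subtractf sum by (simp add: algebra_simps)
  ultimately show ?thesis by simp
qed

text \<open>
  Each complete pass contributes at most \<open>1\<close> to the discrepancy, and the last, incomplete one at
  most its length \<open>d (2 k + 1)\<close>. Up to time \<open>N\<close> there are \<open>k \<le> sqrt N\<close> complete passes, so the total
  is of order \<open>sqrt N\<close>.
\<close>

lemma comb_seq_discrepancy:
  assumes d: "d > 0" and ab: "0 \<le> a" "a \<le> b" "b \<le> 1"
  shows "\<bar>\<Sum>n<N. indicator {a..b} (comb_seq d n) - (b - a)\<bar> \<le> (2 * real d + 1) * sqrt (real N) + real d"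
proof -
  define g where "g = (\<lambda>t. indicator {a..b} t - (b - a))"
  have g: "\<bar>g t\<bar> \<le> 1" for t
    using ab by (auto simp: g_def indicator_def)
  have blocks: "\<bar>\<Sum>n<d * k\<^sup>2. g (comb_seq d n)\<bar> \<le> real k" for k
  proof (induction k)
    case 0
    then show ?case by simp
  next
    case (Suc k)
    have "d * k\<^sup>2 \<le> d * (Suc k)\<^sup>2"
      by (intro mult_le_mono2 power_mono) auto
    then have "(\<Sum>n<d * (Suc k)\<^sup>2. g (comb_seq d n))
        = (\<Sum>n<d * k\<^sup>2. g (comb_seq d n)) + (\<Sum>n=d * k\<^sup>2..<d * (Suc k)\<^sup>2. g (comb_seq d n))"
      by (simp add: sum.atLeastLessThan_concat lessThan_atLeast0)
    moreover have "\<bar>\<Sum>n=d * k\<^sup>2..<d * (Suc k)\<^sup>2. g (comb_seq d n)\<bar> \<le> 1"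
      unfolding comb_seq_block_sum[OF d, of g] unfolding g_def
      by (rule grid_discrepancy[OF ab]) (use d in simp)
    ultimately show ?case using Suc.IH by simp
  qed
  define k where "k = floor_sqrt (N div d)"
  have "d * k\<^sup>2 \<le> d * (N div d)"
    unfolding k_def by (intro mult_le_mono2 floor_sqrt_power2_le)
  then have lo: "d * k\<^sup>2 \<le> N"
    using times_div_less_eq_dividend le_trans by blast
  have "N div d < (Suc k)\<^sup>2"
    unfolding k_def by (rule Suc_floor_sqrt_power2_gt)
  then have "N < d * (Suc k)\<^sup>2"
    using d by (simp add: div_less_iff_less_mult mult.commute)
  then have hi: "N - d * k\<^sup>2 \<le> d * (2 * k + 1)"
    by (simp add: power2_eq_square algebra_simps)
  have "k\<^sup>2 \<le> d * k\<^sup>2" using d by simp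
  then have "real (k\<^sup>2) \<le> real N" using lo by linarith
  then have k: "real k \<le> sqrt (real N)"
    by (intro real_le_rsqrt) simp
  have "(\<Sum>n<N. g (comb_seq d n))
      = (\<Sum>n<d * k\<^sup>2. g (comb_seq d n)) + (\<Sum>n=d * k\<^sup>2..<N. g (comb_seq d n))"
    using lo by (simp add: sum.atLeastLessThan_concat lessThan_atLeast0)
  moreover have "\<bar>\<Sum>n=d * k\<^sup>2..<N. g (comb_seq d n)\<bar> \<le> (\<Sum>n=d * k\<^sup>2..<N. 1)"
    by (rule order_trans[OF sum_abs sum_mono]) (rule g)
  ultimately have "\<bar>\<Sum>n<N. g (comb_seq d n)\<bar> \<le> real k + real (N - d * k\<^sup>2)"
    using blocks[of k] by simp
  also have "\<dots> \<le> real k + real (d * (2 * k + 1))"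
    using hi by linarith
  also have "\<dots> = (2 * real d + 1) * real k + real d"
    by (simp add: algebra_simps)
  also have "\<dots> \<le> (2 * real d + 1) * sqrt (real N) + real d"
    using k by (intro add_mono mult_left_mono) auto
  finally show ?thesis unfolding g_def .
qed

text \<open>The shift of the index accounts for sequences that start at \<open>1\<close>, while the passes start at \<open>0\<close>.\<close>

lemma comb_seq_uniformly_distributed:
  assumes d: "d > 0"
  shows "uniformly_distributed (\<lambda>i. comb_seq d (i - 1))"
  unfolding uniformly_distributed_def
proof (intro conjI allI impI)
  fix a b :: real assume ab: "0 \<le> a \<and> a \<le> b \<and> b \<le> 1"
  let ?A = "\<lambda>n. (1 / real n) * (\<Sum>i=1..n. indicator {a..b} (comb_seq d (i - 1))) :: real"
  have "(\<lambda>n. ?A n - (b - a)) \<longlonglongrightarrow> 0"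
  proof (rule Lim_null_comparison)
    show "(\<lambda>n. ((2 * real d + 1) * sqrt (real n) + real d) / real n) \<longlonglongrightarrow> 0"
      by real_asymp
    show "\<forall>\<^sub>F n in sequentially. norm (?A n - (b - a))
        \<le> ((2 * real d + 1) * sqrt (real n) + real d) / real n"
      using eventually_gt_at_top[of 0]
    proof eventually_elim
      case (elim n)
      have "?A n - (b - a) = (\<Sum>k<n. indicator {a..b} (comb_seq d k) - (b - a)) / real n"
        unfolding sum_subtractf using elim by (simp add: sum.atLeast1_atMost_eq field_simps)
      then show ?case
        using comb_seq_discrepancy[OF d, of a b n] ab elim by (simp add: divide_right_mono)
    qed
  qed
  then show "?A \<longlonglongrightarrow> b - a"
    by (rule LIM_zero_cancel)
qed (rule comb_seq_range[OF d])

lemma comb_seq_windows_eventually_spread: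
  assumes d: "d \<ge> 2" and e: "e > 0"
  shows "\<forall>\<^sub>F i in sequentially. 1 / real d - e \<le> f_min d (\<lambda>j\<in>{1..d}. comb_seq d (i + j - 1 - 1))"
proof -
  have "(\<lambda>k. (1 - 1 / (2 * real k + 1)) / real d) \<longlonglongrightarrow> (1 - 0) / real d"
    by (intro tendsto_intros) (use d in \<open>auto, real_asymp\<close>)
  then have "\<forall>\<^sub>F k in sequentially. 1 / real d - e < (1 - 1 / (2 * real k + 1)) / real d"
    by (rule order_tendstoD(1)) (use e in simp)
  then obtain K where K: "\<And>k. k \<ge> K \<Longrightarrow> 1 / real d - e < (1 - 1 / (2 * real k + 1)) / real d"
    unfolding eventually_sequentially by blast
  show ?thesis
    using eventually_ge_at_top[of "d * K\<^sup>2 + 1"]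
  proof eventually_elim
    case (elim i)
    show ?case
    proof (rule f_min_geI[OF d])
      fix j j' assume j: "j \<in> {1..d}" "j' \<in> {1..d}" "j < j'"
      let ?n = "i + j - 1 - 1" and ?n' = "i + j' - 1 - 1"
      have "d * K\<^sup>2 \<le> ?n" using elim j by simp
      then have "K\<^sup>2 \<le> ?n div d"
        using div_le_mono[of "d * K\<^sup>2" ?n d] d by simp
      then have "K \<le> floor_sqrt (?n div d)"
        by (rule le_floor_sqrtI)
      then have "1 / real d - e < (1 - 1 / (2 * real (floor_sqrt (?n div d)) + 1)) / real d"
        by (rule K)
      also have "\<dots> \<le> \<bar>comb_seq d ?n - comb_seq d ?n'\<bar>"
        using j elim d by (intro comb_seq_separated) auto
      finally show "1 / real d - e
          \<le> \<bar>(\<lambda>j\<in>{1..d}. comb_seq d (i + j - 1 - 1)) j - (\<lambda>j\<in>{1..d}. comb_seq d (i + j - 1 - 1)) j'\<bar>"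
        using j by simp
    qed
  qed
qed

lemma limsup_comb_seq_windows_ge:
  assumes d: "d \<ge> 2"
  shows "ereal (1 / real d) \<le> limsup (\<lambda>n. ereal ((1 / real n) *
    (\<Sum>i=1..n. f_min d (\<lambda>j\<in>{1..d}. comb_seq d (i + j - 1 - 1)))))"
proof (rule ereal_le_epsilon2)
  fix e :: real assume e: "0 < e"
  have "\<forall>\<^sub>F n in sequentially. (1 / real d - e / 2) - e / 2 \<le> (1 / real n) *
      (\<Sum>i=1..n. f_min d (\<lambda>j\<in>{1..d}. comb_seq d (i + j - 1 - 1)))"
    using e by (intro averages_eventually_ge comb_seq_windows_eventually_spread d) auto
  then have "ereal (1 / real d - e) \<le> limsup (\<lambda>n. ereal ((1 / real n) *
      (\<Sum>i=1..n. f_min d (\<lambda>j\<in>{1..d}. comb_seq d (i + j - 1 - 1)))))"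
    by (intro le_Limsup) (auto elim!: eventually_mono)
  then have "ereal (1 / real d - e) + ereal e \<le> limsup (\<lambda>n. ereal ((1 / real n) *
      (\<Sum>i=1..n. f_min d (\<lambda>j\<in>{1..d}. comb_seq d (i + j - 1 - 1))))) + ereal e"
    by (rule add_right_mono)
  then show "ereal (1 / real d) \<le> limsup (\<lambda>n. ereal ((1 / real n) *
      (\<Sum>i=1..n. f_min d (\<lambda>j\<in>{1..d}. comb_seq d (i + j - 1 - 1))))) + ereal e"
    by simp
qed

lemma limsup_windows_le_C_sup:
  assumes x: "x \<in> unif_seqs"
  shows "limsup (\<lambda>n. ereal ((1 / real n) * (\<Sum>i=1..n. f (\<lambda>j\<in>{1..d}. x (i + j - 1)))))
    \<le> C_sup d f"
proof -
  let ?y = "\<lambda>j\<in>{1..d}. \<lambda>i. x (i + j - 1)"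
  have "(\<lambda>i. x (i + j - 1)) \<in> unif_seqs" if "j \<in> {1..d}" for j
    using uniformly_distributed_shift[of x "j - 1"] x that by (simp add: unif_seqs_def)
  then have "?y \<in> {1..d} \<rightarrow>\<^sub>E unif_seqs"
    by auto
  then have "limsup (\<lambda>n. ereal ((1 / real n) * (\<Sum>i=1..n. f (\<lambda>j\<in>{1..d}. ?y j i)))) \<le> C_sup d f"
    unfolding C_sup_def by (rule SUP_upper)
  moreover have "(\<lambda>j\<in>{1..d}. ?y j i) = (\<lambda>j\<in>{1..d}. x (i + j - 1))" for i
    by (rule restrict_ext) simp
  ultimately show ?thesis by simp
qed

section \<open>The optimal constant\<close>

theorem proposition5p2:
  fixes d :: nat
  assumes "d \<ge> 3"
  shows "\<exists>z :: nat \<Rightarrow> nat \<Rightarrow> real.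
    (\<forall>L. z L \<in> unif_seqs) \<and>
    ((\<lambda>L. limsup (\<lambda>n. ereal ((1 / real n) *
        (\<Sum>i=1..n. f_min d (\<lambda>j\<in>{1..d}. z L (i + j - 1))))))
      \<longlonglongrightarrow> ereal (1 / real d)) \<and>
    ereal (1 / real d) = C_sup d (f_min d)"
proof -
  define x where "x = (\<lambda>i. comb_seq d (i - 1))"
  let ?l = "limsup (\<lambda>n. ereal ((1 / real n) * (\<Sum>i=1..n. f_min d (\<lambda>j\<in>{1..d}. x (i + j - 1)))))"
  have x: "x \<in> unif_seqs"
    unfolding x_def unif_seqs_def mem_Collect_eq
    by (rule comb_seq_uniformly_distributed) (use assms in simp)
  have "ereal (1 / real d) \<le> ?l"
    unfolding x_def using assms by (intro limsup_comb_seq_windows_ge) simp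
  moreover have "?l \<le> C_sup d (f_min d)"
    by (rule limsup_windows_le_C_sup[OF x])
  moreover have "C_sup d (f_min d) \<le> ereal (1 / real d)"
    using assms by (intro C_sup_f_min_le) simp
  ultimately have eq: "?l = ereal (1 / real d)" "ereal (1 / real d) = C_sup d (f_min d)"
    by auto
  show ?thesis
    by (intro exI[of _ "\<lambda>L. x"] conjI allI x eq(2)) (subst eq(1), rule tendsto_const)
qed

end
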